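(* For any complex $\alpha$ and any complex $a,b,c$ with $\operatorname{Re}(c-a-b)>0$, $$\sum_{n=0}^\infty \frac{(\alpha)_{a+n}(1-\alpha)_{b+n}}{n!\,\Gamma(c+n+1)}=\frac{(\alpha)_a(1-\alpha)_b\,\Gamma(c-a-b)}{(\alpha)_{c-b}(1-\alpha)_{c-a}}\times\frac{\sin\pi\alpha}{\pi}.$$
   Context: $\Gamma$ is the Euler gamma function. For complex $z,s$, the general rising shifted factorial is $(z)_s=\Gamma(z+s)/\Gamma(z)$; thus $(z)_0=1$, $(z)_n=z(z+1)\cdots(z+n-1)$ for positive integers $n$, and $(z)_{-n}=\frac{1}{(z-1)(z-2)\cdots(z-n)}$ for positive integers $n$. The subscripts $a,b,c-a,c-b$ may be arbitrary complex numbers. The identity is understood for parameters for which the gamma quotients appearing in it are defined, i.e. none of $\alpha$, $1-\alpha$, $\alpha+a$, $1-\alpha+b$ is a non-positive integer; reciprocal gamma values are read via the entire function $1/\Gamma$ (equal to $0$ at the poles of $\Gamma$), so that $1/(z)_s=\Gamma(z)\cdot\frac{1}{\Gamma(z+s)}$. *)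

theory Defs
  imports "HOL-Analysis.Analysis"
begin

text \<open>
  The general rising shifted factorial \<open>(z)\<^sub>s\<close> with complex subscript; the library's
  \<^const>\<open>pochhammer\<close> only takes natural number subscripts.  The library sets
  \<^term>\<open>Gamma z = 0\<close> at the poles and \<open>x / 0 = 0\<close>, so that \<open>1 / Gamma z\<close> is everywhere the
  entire function \<^const>\<open>rGamma\<close>.  The value of \<open>rising z s\<close> is meaningful when neither \<open>z\<close>
  nor \<open>z + s\<close> is a pole of \<open>Gamma\<close>; \<open>1 / rising z s\<close> is meaningful as soon as \<open>z\<close> is not a
  pole (see \<open>inverse_rising\<close>).
\<close>

definition rising :: "complex \<Rightarrow> complex \<Rightarrow> complex" where
  "rising z s = Gamma (z + s) / Gamma z"

lemma inverse_Gamma: "1 / Gamma z = rGamma (z :: complex)"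
  by (simp add: rGamma_inverse_Gamma divide_inverse)

lemma inverse_rising: "1 / rising z s = Gamma z * rGamma (z + s)"
  by (simp add: rising_def rGamma_inverse_Gamma divide_inverse)

lemma rising_of_nat:
  assumes "z \<notin> \<int>\<^sub>\<le>\<^sub>0"
  shows "rising z (of_nat n) = pochhammer z n"
  using assms by (simp add: rising_def pochhammer_Gamma)

lemma rising_minus_of_nat:
  assumes "z - of_nat n \<notin> \<int>\<^sub>\<le>\<^sub>0"
  shows "rising z (- of_nat n) = 1 / (\<Prod>k=1..n. z - of_nat k)"
proof -
  have "pochhammer (z - of_nat n) n = (\<Prod>k=1..n. z - of_nat k)"
    unfolding pochhammer_prod
    by (rule prod.reindex_bij_witness[of _ "\<lambda>k. n - k" "\<lambda>k. n - k"])
       (auto simp: of_nat_diff)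
  moreover have "pochhammer (z - of_nat n) n = Gamma z / Gamma (z - of_nat n)"
    using pochhammer_Gamma[OF assms, of n] by simp
  ultimately show ?thesis
    by (metis rising_def add_uminus_conv_diff inverse_divide inverse_eq_divide)
qed

end

theory Submission
  imports Defs
begin

text \<open>
  The reflection formula turns \<open>sin (\<pi> \<alpha>) / \<pi>\<close> into \<open>1 / (\<Gamma>(\<alpha>) \<Gamma>(1 - \<alpha>))\<close>. Put
  \<open>A = \<alpha> + a\<close>, \<open>B = 1 - \<alpha> + b\<close>, \<open>C = c + 1\<close>. Each term of the series contains the factor
  \<open>(\<alpha>)\<^sub>a (1 - \<alpha>)\<^sub>b\<close>, because \<open>(z)\<^bsub>s+n\<^esub> = (z)\<^sub>s (z + s)\<^sub>n\<close>; after
  cancelling it, the claim is Gauss's evaluation of the hypergeometric function at \<open>1\<close>, in the form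
  divided by \<open>\<Gamma>(C)\<close>, which makes sense for every complex \<open>C\<close>: for \<open>Re (C - A - B) > 0\<close>,

  \<open>(\<Sum>n. (A)\<^sub>n (B)\<^sub>n / (n! \<Gamma>(C + n))) = \<Gamma>(C - A - B) / (\<Gamma>(C - A) \<Gamma>(C - B))\<close>.

  Write \<open>G(C)\<close> for the left-hand side. The proof moves \<open>C\<close> to infinity. A telescoping sum gives the
  contiguous relation \<open>(C - A - B) G(C) = (C - A) (C - B) G(C + 1)\<close>
  (\<open>gauss_sum_contiguous\<close>), and hence
  \<open>(C - A - B)\<^sub>m G(C) = (C - A)\<^sub>m (C - B)\<^sub>m G(C + m)\<close> for all \<open>m\<close>. As \<open>m\<close> tends to infinity, only
  the term \<open>n = 0\<close> of \<open>\<Gamma>(C + m) G(C + m)\<close> survives (\<open>Gamma_gauss_sum_tendsto_1\<close>), while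
  Gauss's product for the gamma function says that \<open>(z)\<^sub>m\<close> and \<open>\<Gamma>(z + m)\<close>, divided by
  \<open>m! m\<^bsup>z-1\<^esup>\<close>, tend to \<open>1 / \<Gamma>(z)\<close> and to \<open>1\<close>. The powers of \<open>m\<close> cancel, and what is left
  of the relation is \<open>G(C) / \<Gamma>(C - A - B) = 1 / (\<Gamma>(C - A) \<Gamma>(C - B))\<close>. The same asymptotics
  bound the terms of \<open>G(C)\<close> by a multiple of \<open>n\<^bsup>-1-\<delta>\<^esup>\<close> with \<open>\<delta> = Re (C - A - B)\<close>. This is where
  the hypothesis enters.
\<close>

section \<open>Growth of Pochhammer symbols and of the gamma function along shifts\<close>

text \<open>
  The leading term of \<open>\<Gamma>(z + n)\<close> as \<open>n\<close> tends to infinity and, up to the constant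
  \<open>1 / \<Gamma>(z)\<close>, also that of \<open>(z)\<^sub>n\<close> if \<open>z\<close> is not a pole of \<open>\<Gamma>\<close>. The factorial is kept so that no Stirling formula is needed.
\<close>
definition gamma_growth :: "complex \<Rightarrow> nat \<Rightarrow> complex" where
  "gamma_growth z n = fact n * of_nat n powr (z - 1)"

lemma gamma_growth_nonzero: "n > 0 \<Longrightarrow> gamma_growth z n \<noteq> 0"
  by (simp add: gamma_growth_def)

lemma gamma_growth_mult:
  assumes "u + v = x + y"
  shows "gamma_growth u n * gamma_growth v n = gamma_growth x n * gamma_growth y n"
proof -
  have "(u - 1) + (v - 1) = (x - 1) + (y - 1)"
    using assms by (simp add: algebra_simps)
  then have "of_nat n powr (u - 1) * of_nat n powr (v - 1)
      = (of_nat n powr (x - 1) * of_nat n powr (y - 1) :: complex)"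
    by (metis powr_add)
  then show ?thesis
    by (simp add: gamma_growth_def algebra_simps)
qed

lemma Re_pos_not_nonpos_Int: "Re z > 0 \<Longrightarrow> z \<notin> \<int>\<^sub>\<le>\<^sub>0"
  by (auto elim!: nonpos_Ints_cases)

lemma shift_ratio_tendsto_1: "(\<lambda>n. (z + of_nat n) / of_nat n :: complex) \<longlonglongrightarrow> 1"
proof -
  have "(\<lambda>n. z * inverse (of_nat n) + 1) \<longlonglongrightarrow> z * 0 + 1"
    by (intro tendsto_intros lim_inverse_n)
  moreover have "\<forall>\<^sub>F n in sequentially. z * inverse (of_nat n) + 1 = (z + of_nat n) / of_nat n"
    using eventually_gt_at_top[of 0]
    by eventually_elim (simp add: field_simps)
  ultimately show ?thesis
    by (simp add: filterlim_cong)
qed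

text \<open>
  This is Gauss's product for \<open>1 / \<Gamma>\<close>; the library's version has one more factor \<open>z + n\<close> in
  the numerator and one more power of \<open>n\<close> in the denominator.
\<close>
lemma pochhammer_asymptotics:
  "(\<lambda>n. pochhammer z n / gamma_growth z n) \<longlonglongrightarrow> rGamma z"
proof -
  have "(\<lambda>n. rGamma_series z n / ((z + of_nat n) / of_nat n)) \<longlonglongrightarrow> rGamma z / 1"
    by (intro tendsto_divide rGamma_series_LIMSEQ shift_ratio_tendsto_1) simp
  moreover have "\<forall>\<^sub>F n in sequentially.
      rGamma_series z n / ((z + of_nat n) / of_nat n) = pochhammer z n / gamma_growth z n"
    using eventually_gt_at_top[of "nat \<lceil>norm z\<rceil>"]
  proof eventually_elim
    case (elim n)
    then have "norm z < real n" "n > 0"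
      by linarith+
    then have "z + of_nat n \<noteq> 0"
      by (metis add_eq_0_iff2 norm_minus_cancel norm_of_nat order_less_irrefl)
    moreover have "exp (z * of_real (ln (of_nat n))) = of_nat n powr z"
      using \<open>n > 0\<close> by (simp add: powr_def)
    ultimately show ?case
      using \<open>n > 0\<close>
      by (simp add: rGamma_series_def gamma_growth_def pochhammer_rec' powr_diff)
  qed
  ultimately show ?thesis
    by (simp add: filterlim_cong)
qed

text \<open>
  If \<open>z\<close> is not a pole, then \<open>\<Gamma>(z + n) = \<Gamma>(z) (z)\<^sub>n\<close> reduces this to the growth of
  the Pochhammer symbol. At a pole that quotient is unavailable, but the claim for \<open>z + 1\<close> implies
  the claim for \<open>z\<close>, so it suffices to start in the right half-plane.
\<close>
lemma rGamma_shift_asymptotics: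
  "(\<lambda>n. rGamma (z + of_nat n) * gamma_growth z n) \<longlonglongrightarrow> 1"
proof -
  have "(\<lambda>n. rGamma (z + of_nat n) * gamma_growth z n) \<longlonglongrightarrow> 1" if "Re z + real k > 0" for k
    using that
  proof (induction k arbitrary: z)
    case 0
    then have nz: "rGamma z \<noteq> 0"
      by (simp add: rGamma_eq_zero_iff Re_pos_not_nonpos_Int)
    have "(\<lambda>n. rGamma z / (pochhammer z n / gamma_growth z n)) \<longlonglongrightarrow> rGamma z / rGamma z"
      using nz by (intro tendsto_intros pochhammer_asymptotics)
    moreover have "rGamma z / (pochhammer z n / gamma_growth z n)
        = rGamma (z + of_nat n) * gamma_growth z n" for n
      using nz pochhammer_rGamma[of z n] by auto
    ultimately show ?case
      using nz by simp
  next
    case (Suc k)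
    have "(\<lambda>n. (z + of_nat n) / of_nat n * (rGamma (z + 1 + of_nat n) * gamma_growth (z + 1) n))
        \<longlonglongrightarrow> 1 * 1"
      using Suc.prems by (intro tendsto_mult shift_ratio_tendsto_1 Suc.IH) simp
    moreover have "\<forall>\<^sub>F n in sequentially.
        (z + of_nat n) / of_nat n * (rGamma (z + 1 + of_nat n) * gamma_growth (z + 1) n)
        = rGamma (z + of_nat n) * gamma_growth z n"
      using eventually_gt_at_top[of 0]
    proof eventually_elim
      case (elim n)
      have "rGamma (z + of_nat n) = (z + of_nat n) * rGamma (z + 1 + of_nat n)"
        using rGamma_plus1[of "z + of_nat n"] by (simp add: add_ac)
      then show ?case
        using elim by (simp add: gamma_growth_def powr_diff)
    qed
    ultimately show ?case
      by (simp add: filterlim_cong)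
  qed
  moreover obtain k :: nat where "- Re z < real k"
    using reals_Archimedean2 by blast
  moreover from this have "Re z + real k > 0"
    by linarith
  ultimately show ?thesis
    by blast
qed

section \<open>The regularized Gauss series\<close>

definition gauss_term :: "complex \<Rightarrow> complex \<Rightarrow> complex \<Rightarrow> nat \<Rightarrow> complex" where
  "gauss_term A B C n = pochhammer A n * pochhammer B n / fact n * rGamma (C + of_nat n)"

definition gauss_sum :: "complex \<Rightarrow> complex \<Rightarrow> complex \<Rightarrow> complex" where
  "gauss_sum A B C = (\<Sum>n. gauss_term A B C n)"

text \<open>
  Substituting the growth of the three gamma-like factors leaves
  \<open>n\<^bsup>A-1\<^esup> n\<^bsup>B-1\<^esup> / n\<^bsup>C-1\<^esup> = n\<^bsup>-1-(C-A-B)\<^esup>\<close>, as the factorials cancel.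
\<close>
lemma gauss_term_asymptotics:
  "(\<lambda>n. of_nat n powr (1 + (C - A - B)) * gauss_term A B C n) \<longlonglongrightarrow> rGamma A * rGamma B"
proof -
  have "(\<lambda>n. pochhammer A n / gamma_growth A n * (pochhammer B n / gamma_growth B n)
          * (rGamma (C + of_nat n) * gamma_growth C n)) \<longlonglongrightarrow> rGamma A * rGamma B * 1"
    by (intro tendsto_mult pochhammer_asymptotics rGamma_shift_asymptotics)
  moreover have "\<forall>\<^sub>F n in sequentially.
      pochhammer A n / gamma_growth A n * (pochhammer B n / gamma_growth B n)
          * (rGamma (C + of_nat n) * gamma_growth C n)
      = of_nat n powr (1 + (C - A - B)) * gauss_term A B C n"
    using eventually_gt_at_top[of 0]
    by eventually_elim
      (simp add: gauss_term_def gamma_growth_def powr_diff powr_add field_simps)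
  ultimately show ?thesis
    by (simp add: filterlim_cong)
qed

lemma summable_norm_gauss_term:
  assumes "Re (C - A - B) > 0"
  shows "summable (\<lambda>n. norm (gauss_term A B C n))"
proof -
  define p where "p = 1 + (C - A - B)"
  have "Bseq (\<lambda>n. of_nat n powr p * gauss_term A B C n)"
    unfolding p_def using gauss_term_asymptotics by (intro convergent_imp_Bseq convergentI)
  then obtain K where K: "\<And>n. norm (of_nat n powr p * gauss_term A B C n) \<le> K"
    by (auto simp: Bseq_def)
  show ?thesis
  proof (rule summable_comparison_test_ev)
    show "summable (\<lambda>n. K * real n powr (- Re p))"
      using assms by (intro summable_mult) (simp add: p_def summable_real_powr_iff)
    show "\<forall>\<^sub>F n in sequentially.
        norm (norm (gauss_term A B C n)) \<le> K * real n powr (- Re p)"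
      using eventually_gt_at_top[of 0]
    proof eventually_elim
      case (elim n)
      have "norm (of_nat n powr p) = real n powr Re p"
        by (simp add: norm_powr_real_powr)
      with K[of n] have "real n powr Re p * norm (gauss_term A B C n) \<le> K"
        by (simp add: norm_mult)
      then show ?case
        using elim by (simp add: powr_minus field_simps)
    qed
  qed
qed

lemma gauss_term_sums:
  assumes "Re (C - A - B) > 0"
  shows "gauss_term A B C sums gauss_sum A B C"
  unfolding gauss_sum_def
  using summable_norm_gauss_term[OF assms] summable_norm_cancel summable_sums by blast

lemma n_times_gauss_term_tendsto_0:
  assumes "Re (C - A - B) > 0"
  shows "(\<lambda>n. of_nat n * gauss_term A B C n) \<longlonglongrightarrow> 0"
proof -
  define d where "d = C - A - B"
  have "(\<lambda>n. real n powr (- Re d)) \<longlonglongrightarrow> 0"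
    using assms by (intro tendsto_neg_powr filterlim_real_sequentially) (simp add: d_def)
  then have "(\<lambda>n. norm (of_nat n powr (- d) :: complex)) \<longlonglongrightarrow> 0"
    by (simp add: norm_powr_real_powr)
  then have "(\<lambda>n. of_nat n powr (- d) :: complex) \<longlonglongrightarrow> 0"
    by (rule tendsto_norm_zero_cancel)
  then have "(\<lambda>n. of_nat n powr (- d) * (of_nat n powr (1 + d) * gauss_term A B C n))
      \<longlonglongrightarrow> 0 * (rGamma A * rGamma B)"
    unfolding d_def by (intro tendsto_mult gauss_term_asymptotics)
  moreover have "\<forall>\<^sub>F n in sequentially.
      of_nat n powr (- d) * (of_nat n powr (1 + d) * gauss_term A B C n)
      = of_nat n * gauss_term A B C n"
    using eventually_gt_at_top[of 0]
    by eventually_elim (simp add: powr_add powr_minus field_simps)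
  ultimately show ?thesis
    by (simp add: filterlim_cong)
qed

section \<open>The contiguous relation\<close>

text \<open>
  Creative telescoping for the contiguous relation. With
  \<open>T = (A)\<^sub>n (B)\<^sub>n / (n! \<Gamma>(C + n + 1))\<close> as common factor, both sides have the cofactor
  \<open>n C - n (A + B) - A B\<close>.
\<close>
lemma gauss_term_telescope:
  "(C - A - B) * gauss_term A B C n - (C - A) * (C - B) * gauss_term A B (C + 1) n
   = of_nat n * gauss_term A B C n - of_nat (Suc n) * gauss_term A B C (Suc n)"
proof -
  define T where
    "T = pochhammer A n * pochhammer B n / fact n * rGamma (C + of_nat n + 1)"
  have t: "gauss_term A B C n = (C + of_nat n) * T"
    by (simp add: gauss_term_def T_def flip: rGamma_plus1[of "C + of_nat n"])
  have t1: "gauss_term A B (C + 1) n = T"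
    by (simp add: gauss_term_def T_def add_ac)
  have tS: "of_nat (Suc n) * gauss_term A B C (Suc n) = (A + of_nat n) * (B + of_nat n) * T"
  proof -
    have "of_nat (Suc n) / fact (Suc n) = (1 / fact n :: complex)"
      by (simp add: divide_simps del: of_nat_Suc)
    moreover have "of_nat (Suc n) * gauss_term A B C (Suc n)
        = of_nat (Suc n) / fact (Suc n) * (pochhammer A (Suc n) * pochhammer B (Suc n)
            * rGamma (C + of_nat (Suc n)))"
      by (simp add: gauss_term_def del: of_nat_Suc fact_Suc)
    ultimately show ?thesis
      by (simp add: T_def pochhammer_Suc add_ac)
  qed
  show ?thesis
    unfolding t t1 tS by (simp add: algebra_simps)
qed

lemma gauss_sum_contiguous:
  assumes "Re (C - A - B) > 0"
  shows "(C - A - B) * gauss_sum A B C = (C - A) * (C - B) * gauss_sum A B (C + 1)"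
proof -
  have "(\<lambda>n. (C - A - B) * gauss_term A B C n - (C - A) * (C - B) * gauss_term A B (C + 1) n)
      sums ((C - A - B) * gauss_sum A B C - (C - A) * (C - B) * gauss_sum A B (C + 1))"
    using assms by (intro sums_diff sums_mult gauss_term_sums) simp_all
  moreover have
    "(\<lambda>n. (C - A - B) * gauss_term A B C n - (C - A) * (C - B) * gauss_term A B (C + 1) n)
      sums (of_nat 0 * gauss_term A B C 0 - 0)"
    unfolding gauss_term_telescope
    using assms by (intro telescope_sums' n_times_gauss_term_tendsto_0)
  ultimately have "(C - A - B) * gauss_sum A B C - (C - A) * (C - B) * gauss_sum A B (C + 1)
      = of_nat 0 * gauss_term A B C 0 - 0"
    by (rule sums_unique2)
  then show ?thesis
    by simp
qed

lemma gauss_sum_shift: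
  assumes "Re (C - A - B) > 0"
  shows "pochhammer (C - A - B) m * gauss_sum A B C
       = pochhammer (C - A) m * pochhammer (C - B) m * gauss_sum A B (C + of_nat m)"
proof (induction m)
  case (Suc m)
  define D where "D = C + of_nat m"
  have step: "(D - A - B) * gauss_sum A B D = (D - A) * (D - B) * gauss_sum A B (D + 1)"
    using assms by (intro gauss_sum_contiguous) (simp add: D_def)
  have "pochhammer (C - A - B) (Suc m) * gauss_sum A B C
      = (D - A - B) * (pochhammer (C - A - B) m * gauss_sum A B C)"
    by (simp add: pochhammer_Suc D_def algebra_simps)
  also have "\<dots> = pochhammer (C - A) m * pochhammer (C - B) m
      * ((D - A - B) * gauss_sum A B D)"
    unfolding Suc.IH D_def by (simp add: mult_ac)
  also have "\<dots> = pochhammer (C - A) m * (D - A) * (pochhammer (C - B) m * (D - B))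
      * gauss_sum A B (D + 1)"
    unfolding step by (simp add: mult_ac)
  also have "\<dots> = pochhammer (C - A) (Suc m) * pochhammer (C - B) (Suc m)
      * gauss_sum A B (C + of_nat (Suc m))"
    by (simp add: pochhammer_Suc D_def algebra_simps)
  finally show ?case .
qed simp

section \<open>Moving the denominator parameter to infinity\<close>

lemma norm_pochhammer_mono:
  fixes z w :: complex
  assumes "\<And>k. norm (z + of_nat k) \<le> norm (w + of_nat k)"
  shows "norm (pochhammer z n) \<le> norm (pochhammer w n)"
  using assms by (simp add: pochhammer_prod prod_mono flip: prod_norm)

text \<open>
  In the right half-plane, \<open>\<bar>(C + m)\<^sub>n\<bar>\<close> increases with \<open>m\<close>, so the series at \<open>C\<close> dominates all
  the shifted ones and Tannery's theorem allows the limit to be taken termwise: every term with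
  \<open>n > 0\<close> contains the factor \<open>1 / (C + m)\<close>. For general \<open>C\<close>, finitely many shifts are dropped.
\<close>
lemma Gamma_gauss_sum_tendsto_1:
  assumes "Re (C - A - B) > 0"
  shows "(\<lambda>m. Gamma (C + of_nat m) * gauss_sum A B (C + of_nat m)) \<longlonglongrightarrow> 1"
proof -
  have right_half_plane: "(\<lambda>m. Gamma (C + of_nat m) * gauss_sum A B (C + of_nat m)) \<longlonglongrightarrow> 1"
    if C: "Re C > 0" "Re (C - A - B) > 0" for C
  proof -
    have notpole: "C + of_nat m \<notin> \<int>\<^sub>\<le>\<^sub>0" for m :: nat
      using C(1) by (simp add: Re_pos_not_nonpos_Int)
    define f where "f = (\<lambda>n m. Gamma (C + of_nat m) * gauss_term A B (C + of_nat m) n)"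
    have f_eq: "f n m = pochhammer A n * pochhammer B n / fact n / pochhammer (C + of_nat m) n"
      for n m
    proof -
      have "rGamma (C + of_nat m) \<noteq> 0"
        using notpole by (simp add: rGamma_eq_zero_iff)
      moreover from this have "pochhammer (C + of_nat m) n \<noteq> 0"
        using pochhammer_rGamma[of "C + of_nat m" n] by auto
      ultimately show ?thesis
        using pochhammer_rGamma[of "C + of_nat m" n]
        by (simp add: f_def gauss_term_def Gamma_def field_simps)
    qed
    have pos: "norm (pochhammer z n) > 0" if "Re z > 0" for z :: complex and n
      using that by (auto simp: pochhammer_eq_0_iff)
    have mono: "norm (pochhammer z n) \<le> norm (pochhammer (z + of_nat m) n)"
      if "Re z > 0" for z :: complex and m n
      using that
      by (intro norm_pochhammer_mono) (auto simp: cmod_def intro!: real_sqrt_le_mono power_mono)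
    have bound: "norm (f n m) \<le> norm (f n 0)" for n m
      unfolding f_eq norm_divide
      using C(1) mono[of C n m] pos[of C n]
      by (intro divide_left_mono mult_pos_pos) auto
    have lim: "(\<lambda>m. f n m) \<longlonglongrightarrow> (if n = 0 then 1 else 0)" for n
    proof (cases n)
      case 0
      then show ?thesis
        by (simp add: f_eq)
    next
      case (Suc k)
      have "filterlim (\<lambda>m. C + of_nat m) at_infinity sequentially"
        by (intro tendsto_add_filterlim_at_infinity[OF tendsto_const]
              tendsto_of_nat)
      then have "(\<lambda>m. inverse (C + of_nat m)) \<longlonglongrightarrow> 0"
        by (rule filterlim_compose[OF tendsto_inverse_0])
      then have *: "(\<lambda>m. norm (f n 0 * C) * norm (inverse (C + of_nat m))) \<longlonglongrightarrow> 0"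
        by (intro tendsto_mult_right_zero tendsto_norm_zero)
      have "norm (f n m) \<le> norm (f n 0 * C) * norm (inverse (C + of_nat m))" for m
      proof -
        define q where "q = pochhammer A n * pochhammer B n / fact n"
        have C0: "C \<noteq> 0"
          using C(1) by auto
        have "f n m = q / pochhammer (C + 1 + of_nat m) k * inverse (C + of_nat m)"
          by (simp add: f_eq q_def Suc pochhammer_rec divide_inverse add_ac del: fact_Suc)
        moreover have "f n 0 * C = q / pochhammer (C + 1) k"
          using C0 by (simp add: f_eq q_def Suc pochhammer_rec del: fact_Suc)
        moreover have "norm (q / pochhammer (C + 1 + of_nat m) k) \<le> norm (q / pochhammer (C + 1) k)"
          unfolding norm_divide
          using C(1) mono[of "C + 1" k m] pos[of "C + 1" k]
          by (intro divide_left_mono mult_pos_pos) auto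
        ultimately show ?thesis
          using mult_right_mono[OF _ norm_ge_zero] by (metis norm_mult)
      qed
      then have "(\<lambda>m. f n m) \<longlonglongrightarrow> 0"
        by (intro Lim_null_comparison[OF _ *]) auto
      then show ?thesis
        using Suc by simp
    qed
    have "(\<lambda>m. \<Sum>n. f n m) \<longlonglongrightarrow> (\<Sum>n. if n = 0 then 1 else 0)"
    proof -
      have "summable (\<lambda>n. norm (f n 0))"
        using summable_norm_gauss_term[OF C(2)] by (simp add: f_def norm_mult summable_mult)
      moreover have "\<forall>\<^sub>F (n, m) in sequentially \<times>\<^sub>F sequentially. norm (f n m) \<le> norm (f n 0)"
        using bound by (intro always_eventually) auto
      ultimately show ?thesis
        using tannerys_theorem[where a = f and F = sequentially, OF lim] by auto
    qed
    moreover have "(\<Sum>n. f n m) = Gamma (C + of_nat m) * gauss_sum A B (C + of_nat m)" for m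
      using C(2) gauss_term_sums[of "C + of_nat m" A B]
      by (simp add: f_def gauss_sum_def suminf_mult sums_iff)
    moreover have "(\<Sum>n. if n = 0 then 1 else 0 :: complex) = 1"
      using sums_single[of 0 "\<lambda>_. 1 :: complex"] by (simp add: sums_iff)
    ultimately show ?thesis
      by simp
  qed
  obtain N :: nat where N: "- Re C < real N"
    using reals_Archimedean2 by blast
  have "(\<lambda>m. Gamma (C + of_nat N + of_nat m) * gauss_sum A B (C + of_nat N + of_nat m))
      \<longlonglongrightarrow> 1"
    using assms N by (intro right_half_plane) auto
  then have "(\<lambda>m. Gamma (C + of_nat (m + N)) * gauss_sum A B (C + of_nat (m + N))) \<longlonglongrightarrow> 1"
    by (simp add: add_ac)
  then show ?thesis
    by (rule LIMSEQ_offset)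
qed

section \<open>Gauss's summation theorem\<close>

text \<open>
  After division by the growth functions, whose exponents balance because
  \<open>(C - A) + (C - B) = (C - A - B) + C\<close>, every factor of \<open>gauss_sum_shift\<close> has a limit.
\<close>
lemma gauss_sum_eq:
  assumes "Re (C - A - B) > 0"
  shows "gauss_sum A B C = Gamma (C - A - B) * rGamma (C - A) * rGamma (C - B)"
proof -
  define P where "P = (\<lambda>z m. pochhammer z m / gamma_growth z m)"
  have "(\<lambda>m. P (C - A) m * P (C - B) m * (rGamma (C + of_nat m) * gamma_growth C m)
          * (Gamma (C + of_nat m) * gauss_sum A B (C + of_nat m)))
      \<longlonglongrightarrow> rGamma (C - A) * rGamma (C - B) * 1 * 1"
    unfolding P_def
    by (intro tendsto_mult pochhammer_asymptotics rGamma_shift_asymptotics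
          Gamma_gauss_sum_tendsto_1 assms)
  moreover have "\<forall>\<^sub>F m in sequentially.
      P (C - A) m * P (C - B) m * (rGamma (C + of_nat m) * gamma_growth C m)
          * (Gamma (C + of_nat m) * gauss_sum A B (C + of_nat m))
      = P (C - A - B) m * gauss_sum A B C"
    \<comment> \<open>From this index on, \<open>C + m\<close> is not a pole, so the inserted factor \<open>\<Gamma>(C + m) / \<Gamma>(C + m)\<close> is \<open>1\<close>.\<close>
    using eventually_gt_at_top[of "nat \<lceil>norm C\<rceil>"]
  proof eventually_elim
    case (elim m)
    then have m: "norm C < real m" "m > 0"
      by linarith+
    have "Re C + real m > 0"
      using m(1) abs_Re_le_cmod[of C] by linarith
    then have "C + of_nat m \<notin> \<int>\<^sub>\<le>\<^sub>0"
      by (simp add: Re_pos_not_nonpos_Int)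
    then have "rGamma (C + of_nat m) * Gamma (C + of_nat m) = 1"
      by (simp add: Gamma_def rGamma_eq_zero_iff)
    then have "P (C - A) m * P (C - B) m * (rGamma (C + of_nat m) * gamma_growth C m)
          * (Gamma (C + of_nat m) * gauss_sum A B (C + of_nat m))
        = P (C - A) m * P (C - B) m * gamma_growth C m * gauss_sum A B (C + of_nat m)"
      by (simp add: algebra_simps)
    also have "\<dots> = (pochhammer (C - A) m * pochhammer (C - B) m
          * gauss_sum A B (C + of_nat m)) * (gamma_growth C m
            / (gamma_growth (C - A) m * gamma_growth (C - B) m))"
      by (simp add: P_def)
    also have "gamma_growth (C - A) m * gamma_growth (C - B) m
        = gamma_growth (C - A - B) m * gamma_growth C m"
      by (rule gamma_growth_mult) simp
    also have "gamma_growth C m / \<dots> = 1 / gamma_growth (C - A - B) m"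
      using gamma_growth_nonzero[OF m(2)] by simp
    finally show ?case
      by (simp add: P_def flip: gauss_sum_shift[OF assms])
  qed
  ultimately have "(\<lambda>m. P (C - A - B) m * gauss_sum A B C) \<longlonglongrightarrow> rGamma (C - A) * rGamma (C - B)"
    by (simp add: filterlim_cong)
  moreover have "(\<lambda>m. P (C - A - B) m * gauss_sum A B C)
      \<longlonglongrightarrow> rGamma (C - A - B) * gauss_sum A B C"
    unfolding P_def by (intro tendsto_mult tendsto_const pochhammer_asymptotics)
  ultimately have "rGamma (C - A - B) * gauss_sum A B C = rGamma (C - A) * rGamma (C - B)"
    by (metis LIMSEQ_unique)
  moreover have "C - A - B \<notin> \<int>\<^sub>\<le>\<^sub>0"
    using assms by (rule Re_pos_not_nonpos_Int)
  then have "rGamma (C - A - B) \<noteq> 0"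
    by (simp add: rGamma_eq_zero_iff)
  ultimately show ?thesis
    by (simp add: Gamma_def field_simps)
qed

theorem theorem1p2:
  fixes \<alpha> a b c :: complex
  assumes "Re (c - a - b) > 0"
    and "\<alpha> \<notin> \<int>\<^sub>\<le>\<^sub>0" and "1 - \<alpha> \<notin> \<int>\<^sub>\<le>\<^sub>0"
    and "\<alpha> + a \<notin> \<int>\<^sub>\<le>\<^sub>0" and "1 - \<alpha> + b \<notin> \<int>\<^sub>\<le>\<^sub>0"
  shows "(\<lambda>n. rising \<alpha> (a + of_nat n) * rising (1 - \<alpha>) (b + of_nat n)
              / (fact n * Gamma (c + of_nat n + 1)))
         sums
         (rising \<alpha> a * rising (1 - \<alpha>) b * Gamma (c - a - b)
              / (rising \<alpha> (c - b) * rising (1 - \<alpha>) (c - a))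
            * (sin (of_real pi * \<alpha>) / of_real pi))"
proof -
  define A where "A = \<alpha> + a"
  define B where "B = 1 - \<alpha> + b"
  define C where "C = c + 1"
  have ABC: "C - A - B = c - a - b" "C - A = 1 - \<alpha> + (c - a)" "C - B = \<alpha> + (c - b)"
    by (simp_all add: A_def B_def C_def)
  have nz: "Gamma \<alpha> \<noteq> 0" "Gamma (1 - \<alpha>) \<noteq> 0"
    using assms by (simp_all add: Gamma_eq_zero_iff)
  have split: "rising z (s + of_nat n) = rising z s * pochhammer (z + s) n"
    if "z + s \<notin> \<int>\<^sub>\<le>\<^sub>0" for z s n
    using pochhammer_Gamma[OF that, of n] that
    by (simp add: rising_def Gamma_eq_zero_iff add_ac)
  have "(\<lambda>n. rising \<alpha> a * rising (1 - \<alpha>) b * gauss_term A B C n)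
      sums (rising \<alpha> a * rising (1 - \<alpha>) b
        * (Gamma (C - A - B) * rGamma (C - A) * rGamma (C - B)))"
    using assms(1) gauss_term_sums[of C A B] gauss_sum_eq[of C A B]
    unfolding ABC(1) by (intro sums_mult) simp
  moreover have "rising \<alpha> a * rising (1 - \<alpha>) b * gauss_term A B C n
      = rising \<alpha> (a + of_nat n) * rising (1 - \<alpha>) (b + of_nat n)
          / (fact n * Gamma (c + of_nat n + 1))" for n
    unfolding split[OF assms(4)] split[OF assms(5)]
    by (simp add: gauss_term_def A_def B_def C_def rGamma_inverse_Gamma add_ac divide_inverse)
  moreover have "rising \<alpha> a * rising (1 - \<alpha>) b
        * (Gamma (C - A - B) * rGamma (C - A) * rGamma (C - B))
      = rising \<alpha> a * rising (1 - \<alpha>) b * Gamma (c - a - b)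
          / (rising \<alpha> (c - b) * rising (1 - \<alpha>) (c - a))
        * (sin (of_real pi * \<alpha>) / of_real pi)"
  proof -
    define R where "R = rising \<alpha> (c - b) * rising (1 - \<alpha>) (c - a)"
    have R: "1 / R = Gamma \<alpha> * rGamma (C - B) * (Gamma (1 - \<alpha>) * rGamma (C - A))"
      unfolding R_def ABC inverse_rising[symmetric] by simp
    have S: "sin (of_real pi * \<alpha>) / of_real pi = 1 / (Gamma \<alpha> * Gamma (1 - \<alpha>))"
      using Gamma_reflection_complex[of \<alpha>] by simp
    have "rGamma (C - A) * rGamma (C - B) = 1 / R * (sin (of_real pi * \<alpha>) / of_real pi)"
      using nz unfolding R S by simp
    then have "rising \<alpha> a * rising (1 - \<alpha>) b * Gamma (c - a - b)
          * (rGamma (C - A) * rGamma (C - B))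
        = rising \<alpha> a * rising (1 - \<alpha>) b * Gamma (c - a - b)
          * (1 / R * (sin (of_real pi * \<alpha>) / of_real pi))"
      by (rule arg_cong)
    then show ?thesis
      unfolding ABC(1) R_def[symmetric] by (simp add: mult.assoc)
  qed
  ultimately show ?thesis
    by simp
qed

end
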